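(* Let $1<q\le p<\infty$, $1<s<\infty$ and $\gamma>0$, and assume that \[ \frac nq-\frac np<\gamma<n-\frac np . \] Then the following assertions hold: (1) If $q\le s$, then there exists $C>0$ such that for all $t>0$ and all $f\in\mathcal M^p_q(\mathbb R^n)$, \[ \|e^{t\Delta}[|\cdot|^{-\gamma}f]\|_{L^{s,\infty}} \le C\, t^{-\frac n2\left(\frac1p-\frac1s\right)-\frac\gamma2} \|f\|_{\mathcal M^p_q}. \] (2) If $q<s$, then there exists $C>0$ such that for all $t>0$ and all $f\in\mathcal M^p_q(\mathbb R^n)$, \[ \|e^{t\Delta}[|\cdot|^{-\gamma}f]\|_{L^s} \le C\, t^{-\frac n2\left(\frac1p-\frac1s\right)-\frac\gamma2} \|f\|_{\mathcal M^p_q}. \]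
   Context: Here $n\ge1$ is the dimension. The heat semigroup $\{e^{t\Delta}\}_{t>0}$ is defined by \[ e^{t\Delta}f(x)=\frac1{\sqrt{(4\pi t)^n}}\int_{\mathbb R^n}\exp\left(-\frac{|x-y|^2}{4t}\right)f(y)\,dy,\quad (t,x)\in(0,\infty)\times\mathbb R^n, \] and $|\cdot|^{-\gamma}f$ denotes the function $x\mapsto|x|^{-\gamma}f(x)$. $L^s(\mathbb R^n)$ is the usual Lebesgue space with norm $\|f\|_{L^s}=\left(\int_{\mathbb R^n}|f(x)|^s\,dx\right)^{1/s}$. For $1\le p<\infty$, the weak Lebesgue space $L^{p,\infty}(\mathbb R^n)$ is the space of all measurable functions $f$ with finite quasi-norm \[ \|f\|_{L^{p,\infty}}=\sup_{\lambda>0}\lambda\,\|\chi_{\{x\in\mathbb R^n:|f(x)|>\lambda\}}\|_{L^p}. \] For $1\le q\le p<\infty$, the Morrey space $\mathcal M^p_q(\mathbb R^n)$ is the space of all measurable functions $f$ with finite norm \[ \|f\|_{\mathcal M^p_q}=\sup_{x\in\mathbb R^n,\,\rho>0}\rho^{\frac np-\frac nq}\left(\int_{B(x,\rho)}|f(y)|^q\,dy\right)^{\frac1q}, \] where $B(x,\rho)$ is the ball with center $x$ and radius $\rho$. *)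

theory Defs
  imports "HOL-Analysis.Analysis"
begin

text \<open>
  All norms take values in \<^typ>\<open>ennreal\<close>; a measurable function belongs to the
  corresponding space iff its norm is finite. Measurable means Lebesgue measurable.
\<close>

definition ennroot :: "real \<Rightarrow> ennreal \<Rightarrow> ennreal" where
  "ennroot s a = (if a = \<infinity> then \<infinity> else ennreal (enn2real a powr (1 / s)))"

definition L_norm :: "real \<Rightarrow> (real ^ 'n::finite \<Rightarrow> 'b::real_normed_vector) \<Rightarrow> ennreal" where
  "L_norm s f = ennroot s (\<integral>\<^sup>+ x. ennreal (norm (f x) powr s) \<partial>lebesgue)"

definition weak_L_norm :: "real \<Rightarrow> (real ^ 'n::finite \<Rightarrow> complex) \<Rightarrow> ennreal" where
  "weak_L_norm p f =
     (SUP l\<in>{0<..}. ennreal l * L_norm p (indicator {x. norm (f x) > l} :: real ^ 'n \<Rightarrow> real))"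

definition morrey_norm :: "real \<Rightarrow> real \<Rightarrow> (real ^ 'n::finite \<Rightarrow> complex) \<Rightarrow> ennreal" where
  "morrey_norm p q f =
     (SUP (x, \<rho>)\<in>UNIV \<times> {0<..}.
        ennreal (\<rho> powr (real CARD('n) / p - real CARD('n) / q)) *
        ennroot q (\<integral>\<^sup>+ y\<in>ball x \<rho>. ennreal (norm (f y) powr q) \<partial>lebesgue))"

definition morrey_space :: "real \<Rightarrow> real \<Rightarrow> (real ^ 'n::finite \<Rightarrow> complex) set" where
  "morrey_space p q = {f \<in> borel_measurable lebesgue. morrey_norm p q f < \<infinity>}"

definition heat_integrand ::
    "real \<Rightarrow> (real ^ 'n::finite \<Rightarrow> complex) \<Rightarrow> real ^ 'n \<Rightarrow> real ^ 'n \<Rightarrow> complex" where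
  "heat_integrand t f x y = exp (- ((norm (x - y))\<^sup>2 / (4 * t))) *\<^sub>R f y"

text \<open>
  The Bochner integral is 0 for a non-integrable integrand, so \<open>heat t f x\<close> is meaningful only
  under \<open>heat_defined\<close>: absolute convergence at every point of $R^n$.
\<close>

definition heat_defined :: "real \<Rightarrow> (real ^ 'n::finite \<Rightarrow> complex) \<Rightarrow> bool" where
  "heat_defined t f \<longleftrightarrow> (\<forall>x. integrable lebesgue (heat_integrand t f x))"

definition heat :: "real \<Rightarrow> (real ^ 'n::finite \<Rightarrow> complex) \<Rightarrow> real ^ 'n \<Rightarrow> complex" where
  "heat t f x =
     (1 / sqrt ((4 * pi * t) ^ CARD('n))) *\<^sub>R (\<integral>y. heat_integrand t f x y \<partial>lebesgue)"

text \<open>The value at the origin is 0 by the convention for \<open>powr\<close>; it is irrelevant.\<close>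

definition singular_weight ::
    "real \<Rightarrow> (real ^ 'n::finite \<Rightarrow> complex) \<Rightarrow> real ^ 'n \<Rightarrow> complex" where
  "singular_weight \<gamma> f x = (norm x powr (- \<gamma>)) *\<^sub>R f x"

end

theory Submission
  imports Defs "HOL-Probability.Distributions"
begin

text \<open>
  Everything rests on one observation: the two inequalities for $\gamma$ ensure that, for $f$ in the Morrey
  space, $|x|^{-\gamma} f$ is the sum of an $L^1$ function supported near the origin and an $L^q$ function
  supported away from it. The Morrey norm bounds $\int_{B(0,\rho)} |f|^q$ by a multiple of $\rho^{n - nq/p}$ and, by
  Hoelder's inequality, $\int_{B(0,\rho)} |f|$ by a multiple of $\rho^{n - n/p}$. Summing over dyadic shells, the
  weight $|x|^{-\gamma}$ is summable against the second bound near $0$ because $\gamma < n - n/p$, and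
  $|x|^{-\gamma q}$ against the first near infinity because $\gamma q > n - nq/p$
  (\<open>nn_integral_weight_ball\<close>, \<open>nn_integral_weight_outside_ball\<close>).

  The Gaussian maps $L^1$ and $L^q$ to $L^s$ for every $s \ge q$ (\<open>symmetric_kernel_smoothing\<close>), with
  norms bounded by multiples of $t^{-\frac n2 (1 - \frac1s)}$ and $t^{-\frac n2 (\frac1q - \frac1s)}$. Cutting at
  $|x| = \sqrt t$ makes the two contributions scale alike and gives the asserted power of $t$
  (\<open>heat_singular_weight_morrey\<close>).

  This proves the strong $L^s$ estimate for all $s \ge q$, the endpoint included, and so the weak estimate
  is a consequence of Chebyshev's inequality (\<open>weak_L_norm_le_L_norm\<close>).
\<close>

section \<open>Roots of extended reals and the weak norm\<close>

lemma ennroot_le: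
  assumes "X \<le> ennreal (B powr s)" "0 \<le> B" "0 < s"
  shows "ennroot s X \<le> ennreal B"
proof -
  from assms(1) have fin: "X \<noteq> \<infinity>" by (auto simp: top_unique)
  have "enn2real X \<le> B powr s" using assms(1) by (simp add: enn2real_leI)
  then have "enn2real X powr (1/s) \<le> (B powr s) powr (1/s)"
    using assms by (intro powr_mono2) auto
  also have "\<dots> = B" using assms by (simp add: powr_powr)
  finally show ?thesis using fin by (simp add: ennroot_def ennreal_leI)
qed

lemma le_of_ennroot_le:
  assumes "ennroot s X \<le> ennreal B" "0 < s"
  shows "X \<le> ennreal (B powr s)"
proof -
  have fin: "X \<noteq> \<infinity>" using assms by (auto simp: ennroot_def top_unique)
  have le: "enn2real X powr (1/s) \<le> B" if "B \<ge> 0"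
    using assms fin that by (simp add: ennroot_def)
  have X: "X = ennreal (enn2real X)" using fin by (simp add: less_top)
  show ?thesis
  proof (cases "B \<ge> 0")
    case True
    have "enn2real X = (enn2real X powr (1/s)) powr s" using assms by (simp add: powr_powr)
    also have "\<dots> \<le> B powr s" using le[OF True] assms by (intro powr_mono2) auto
    finally show ?thesis by (subst X) (rule ennreal_leI)
  next
    case False
    then have "ennreal B = 0" by (simp add: ennreal_neg)
    then have "enn2real X powr (1/s) \<le> 0" using assms fin by (simp add: ennroot_def)
    then have "enn2real X = 0" by simp
    then show ?thesis by (subst X) simp
  qed
qed

text \<open>
  Chebyshev's inequality: $\lambda^s \chi_{\{|f| > \lambda\}} \le |f|^s$ pointwise. It reduces the weak
  type estimate to the strong one.
\<close>

lemma weak_L_norm_le_L_norm: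
  fixes f :: "real ^ 'n \<Rightarrow> complex"
  assumes [measurable]: "f \<in> borel_measurable lebesgue" and "0 < s"
  shows "weak_L_norm s f \<le> L_norm s f"
  unfolding weak_L_norm_def
proof (rule SUP_least)
  fix l :: real assume "l \<in> {0<..}"
  then have l: "l > 0" by simp
  show "ennreal l * L_norm s (indicator {x. norm (f x) > l} :: real ^ 'n \<Rightarrow> real) \<le> L_norm s f"
  proof (cases "L_norm s f = \<infinity>")
    case False
    define B where "B = enn2real (L_norm s f)"
    have B: "L_norm s f = ennreal B" "B \<ge> 0" using False by (simp_all add: B_def less_top)
    have "(\<integral>\<^sup>+ x. ennreal (norm (indicator {x. norm (f x) > l} x :: real) powr s) \<partial>lebesgue)
        \<le> (\<integral>\<^sup>+ x. ennreal (1 / l powr s) * ennreal (norm (f x) powr s) \<partial>lebesgue)"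
    proof (rule nn_integral_mono)
      fix x
      have "1 \<le> 1 / l powr s * norm (f x) powr s" if "norm (f x) > l"
        using that l \<open>0 < s\<close> by (simp add: powr_mono2)
      then show "ennreal (norm (indicator {x. norm (f x) > l} x :: real) powr s)
          \<le> ennreal (1 / l powr s) * ennreal (norm (f x) powr s)"
        by (auto simp: indicator_def ennreal_mult'[symmetric] simp del: times_divide_eq_left
            intro!: ennreal_leI)
    qed
    also have "\<dots> = ennreal (1 / l powr s) * (\<integral>\<^sup>+ x. ennreal (norm (f x) powr s) \<partial>lebesgue)"
      by (rule nn_integral_cmult) measurable
    also have "\<dots> \<le> ennreal (1 / l powr s) * ennreal (B powr s)"
      using B \<open>0 < s\<close> by (intro mult_left_mono le_of_ennroot_le) (auto simp: L_norm_def)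
    also have "\<dots> = ennreal ((B / l) powr s)"
      using B l by (simp add: ennreal_mult'[symmetric] powr_divide)
    finally have "L_norm s (indicator {x. norm (f x) > l} :: real ^ 'n \<Rightarrow> real) \<le> ennreal (B / l)"
      unfolding L_norm_def using B l \<open>0 < s\<close> by (intro ennroot_le) auto
    then have "ennreal l * L_norm s (indicator {x. norm (f x) > l} :: real ^ 'n \<Rightarrow> real)
        \<le> ennreal l * ennreal (B / l)" by (rule mult_left_mono) simp
    also have "\<dots> = ennreal B" using l B by (simp add: ennreal_mult'[symmetric])
    finally show ?thesis by (simp add: B)
  qed simp
qed

section \<open>Weighted Hoelder inequality and smoothing by a symmetric kernel\<close>

lemma ennreal_lincomb:
  assumes "0 \<le> c" "0 \<le> a" "0 \<le> d" "0 \<le> b"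
  shows "ennreal c * ennreal a + ennreal d * ennreal b = ennreal (c * a + d * b)"
  using assms by (simp add: ennreal_mult')

text \<open>
  Instead of factoring $w h = w^{1-1/r} \cdot w^{1/r} h$, integrate the tangent-line bound
  $h \le \frac1r \mu^{1-r} h^r + (1 - \frac1r) \mu$ against $w$ and optimise over the constant
  $\mu > 0$; the bound is Young's inequality for the product $(h^r \mu^{1-r})^{1/r} \mu^{1-1/r}$.
\<close>

lemma Hoelder_weighted:
  fixes w h :: "'a \<Rightarrow> real"
  assumes [measurable]: "w \<in> borel_measurable M" "h \<in> borel_measurable M"
    and nn: "\<And>x. 0 \<le> w x" "\<And>x. 0 \<le> h x"
    and r: "1 \<le> r" and W: "0 < W" and A: "0 \<le> A"
    and wW: "(\<integral>\<^sup>+x. ennreal (w x) \<partial>M) \<le> ennreal W"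
    and whA: "(\<integral>\<^sup>+x. ennreal (w x * h x powr r) \<partial>M) \<le> ennreal A"
  shows "(\<integral>\<^sup>+x. ennreal (w x * h x) \<partial>M) \<le> ennreal (W powr (1 - 1/r) * A powr (1/r))"
proof (cases "A = 0")
  case True
  then have "(\<integral>\<^sup>+x. ennreal (w x * h x powr r) \<partial>M) = 0" using whA by simp
  then have "AE x in M. ennreal (w x * h x powr r) = 0" by (subst (asm) nn_integral_0_iff_AE) auto
  then have "AE x in M. ennreal (w x * h x) = 0"
  proof (rule AE_mp, intro AE_I2 impI)
    fix x assume "ennreal (w x * h x powr r) = 0"
    then have "w x * h x powr r = 0" using nn[of x] by simp
    then show "ennreal (w x * h x) = 0" by auto
  qed
  then have "(\<integral>\<^sup>+x. ennreal (w x * h x) \<partial>M) = 0" by (subst nn_integral_0_iff_AE) auto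
  then show ?thesis by simp
next
  case False
  with A have A: "A > 0" by simp
  \<comment> \<open>The minimiser of the integrated bound, at which its two terms balance.\<close>
  define \<mu> where "\<mu> = (A / W) powr (1/r)"
  have \<mu>: "\<mu> > 0" using A W by (simp add: \<mu>_def)
  have young: "h x \<le> (1/r) * \<mu> powr (1 - r) * h x powr r + (1 - 1/r) * \<mu>" for x
  proof (cases "h x = 0")
    case True
    then show ?thesis using \<mu> r by simp
  next
    case False
    then have h: "h x > 0" using nn(2)[of x] by simp
    have "(h x powr r * \<mu> powr (1 - r)) powr (1/r) * \<mu> powr (1 - 1/r)
        \<le> (1/r) * (h x powr r * \<mu> powr (1 - r)) + (1 - 1/r) * \<mu>"
      using r h \<mu> by (intro Youngs_inequality_0) auto
    moreover have "(h x powr r * \<mu> powr (1 - r)) powr (1/r) * \<mu> powr (1 - 1/r) = h x"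
    proof -
      have "(h x powr r * \<mu> powr (1 - r)) powr (1/r) = h x * \<mu> powr ((1 - r) * (1/r))"
        using h \<mu> r by (simp add: powr_mult powr_powr)
      moreover have "\<mu> powr ((1 - r) * (1/r)) * \<mu> powr (1 - 1/r) = 1"
        using \<mu> r by (simp add: powr_add[symmetric] diff_divide_distrib)
      ultimately show ?thesis by simp
    qed
    ultimately show ?thesis by (simp add: mult_ac)
  qed
  have "(\<integral>\<^sup>+x. ennreal (w x * h x) \<partial>M)
     \<le> (\<integral>\<^sup>+x. ennreal ((1/r) * \<mu> powr (1 - r)) * ennreal (w x * h x powr r)
            + ennreal ((1 - 1/r) * \<mu>) * ennreal (w x) \<partial>M)"
  proof (rule nn_integral_mono)
    fix x
    have "w x * h x \<le> w x * ((1/r) * \<mu> powr (1 - r) * h x powr r + (1 - 1/r) * \<mu>)"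
      by (rule mult_left_mono[OF young nn(1)])
    also have "\<dots> = (1/r) * \<mu> powr (1 - r) * (w x * h x powr r) + (1 - 1/r) * \<mu> * w x"
      by (simp add: algebra_simps)
    finally have "ennreal (w x * h x)
        \<le> ennreal ((1/r) * \<mu> powr (1 - r) * (w x * h x powr r) + (1 - 1/r) * \<mu> * w x)"
      by (rule ennreal_leI)
    then show "ennreal (w x * h x) \<le> ennreal ((1/r) * \<mu> powr (1 - r)) * ennreal (w x * h x powr r)
            + ennreal ((1 - 1/r) * \<mu>) * ennreal (w x)"
      using r nn \<mu> by (subst ennreal_lincomb) auto
  qed
  also have "\<dots> = ennreal ((1/r) * \<mu> powr (1 - r)) * (\<integral>\<^sup>+x. ennreal (w x * h x powr r) \<partial>M)
       + ennreal ((1 - 1/r) * \<mu>) * (\<integral>\<^sup>+x. ennreal (w x) \<partial>M)"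
    by (simp add: nn_integral_add nn_integral_cmult)
  also have "\<dots> \<le> ennreal ((1/r) * \<mu> powr (1 - r)) * ennreal A + ennreal ((1 - 1/r) * \<mu>) * ennreal W"
    by (intro add_mono mult_left_mono wW whA) auto
  also have "\<dots> = ennreal ((1/r) * (\<mu> powr (1 - r) * A) + (1 - 1/r) * (\<mu> * W))"
    using r \<mu> A W by (subst ennreal_lincomb) (auto simp: mult.assoc)
  also have "(1/r) * (\<mu> powr (1 - r) * A) + (1 - 1/r) * (\<mu> * W) = W powr (1 - 1/r) * A powr (1/r)"
  proof -
    have "\<mu> = A powr (1/r) / W powr (1/r)" using A W by (simp add: \<mu>_def powr_divide)
    moreover have "W powr (1 - 1/r) = W / W powr (1/r)" using W by (subst powr_diff) simp
    ultimately have 1: "\<mu> * W = W powr (1 - 1/r) * A powr (1/r)" by simp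
    have "\<mu> powr r = A / W" using A W r by (simp add: \<mu>_def powr_powr)
    then have 2: "\<mu> powr (1 - r) * A = \<mu> * W" using A W \<mu> by (subst powr_diff) simp
    show ?thesis unfolding 2 1 by (simp add: left_diff_distrib)
  qed
  finally show ?thesis .
qed

section \<open>The Gaussian kernel\<close>

text \<open>
  Tonelli is applied to the completed Lebesgue measure itself, because the functions of a Morrey
  space are only Lebesgue measurable.
\<close>

lemma sigma_finite_lebesgue: "sigma_finite_measure (lebesgue :: 'a::euclidean_space measure)"
proof
  obtain A :: "'a set set" where A: "countable A" "A \<subseteq> sets lborel" "\<Union>A = space lborel"
    "\<forall>a\<in>A. emeasure lborel a \<noteq> \<infinity>"
    using lborel.sigma_finite_countable by metis
  have sets: "A \<subseteq> sets lebesgue" using A(2) sets_completionI_sets by blast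
  moreover have "\<Union>A = space lebesgue" using A(3) by simp
  moreover have "\<forall>a\<in>A. emeasure lebesgue a \<noteq> \<infinity>"
  proof
    fix a assume a: "a \<in> A"
    then have "a \<in> sets lborel" using A(2) by blast
    then have "emeasure lebesgue a = emeasure lborel a" by (simp add: emeasure_completion)
    then show "emeasure lebesgue a \<noteq> \<infinity>" using A(4) a by simp
  qed
  ultimately show "\<exists>A. countable A \<and> A \<subseteq> sets (lebesgue :: 'a measure) \<and> \<Union>A = space lebesgue \<and>
     (\<forall>a\<in>A. emeasure lebesgue a \<noteq> \<infinity>)"
    using A(1) by blast
qed

text \<open>
  The special case of Young's convolution inequality that maps $L^r$ to $L^s$ for $r \le s$, for a
  kernel with $0 \le k \le 1$ in place of a convolution kernel. Hoelder's inequality gives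
  $(Hx)^r \le G^{r-1} Jx$ with $Jx = \int k(x,y) h(y)^r \, dy$. Since $k \le 1$, $J$ is bounded by
  $\|h\|_r^r$, which yields the sup bound; by Tonelli and the symmetry of $k$, $\int J \le G \|h\|_r^r$.
  The $L^s$ bound interpolates between the two, because $H^s = H^{s-r} H^r$. Real powers are
  taken of \<^const>\<open>enn2real\<close>; the sup bound makes $H$ finite, so no information is lost.
\<close>

lemma symmetric_kernel_smoothing:
  fixes M :: "'a measure" and k :: "'a \<Rightarrow> 'a \<Rightarrow> real" and h :: "'a \<Rightarrow> real" and r s A G :: real
  defines "H \<equiv> (\<lambda>x. \<integral>\<^sup>+y. ennreal (k x y * h y) \<partial>M)"
  assumes M: "sigma_finite_measure M"
    and k_meas [measurable]: "case_prod k \<in> borel_measurable (M \<Otimes>\<^sub>M M)"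
    and k: "\<And>x y. 0 \<le> k x y" "\<And>x y. k x y \<le> 1" "\<And>x y. k x y = k y x"
    and G: "0 < G" "\<And>x. x \<in> space M \<Longrightarrow> (\<integral>\<^sup>+y. ennreal (k x y) \<partial>M) \<le> ennreal G"
    and h_meas [measurable]: "h \<in> borel_measurable M" and h: "\<And>y. 0 \<le> h y"
    and r: "1 \<le> r" and s: "r \<le> s" and A: "0 \<le> A"
    and hA: "(\<integral>\<^sup>+y. ennreal (h y powr r) \<partial>M) \<le> ennreal (A powr r)"
  shows "x \<in> space M \<Longrightarrow> H x \<le> ennreal (G powr (1 - 1/r) * A)"
    and "(\<integral>\<^sup>+x. ennreal (enn2real (H x) powr s) \<partial>M) \<le> ennreal (G powr (s + 1 - s/r) * A powr s)"
proof -
  interpret L: sigma_finite_measure M by (rule M)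
  interpret P: pair_sigma_finite M M ..
  define J where "J = (\<lambda>x. \<integral>\<^sup>+y. ennreal (k x y * h y powr r) \<partial>M)"
  have J_meas [measurable]: "J \<in> borel_measurable M"
    unfolding J_def by measurable
  have JA: "J x \<le> ennreal (A powr r)" for x
  proof -
    have "J x \<le> (\<integral>\<^sup>+y. ennreal (h y powr r) \<partial>M)"
      unfolding J_def using k
      by (intro nn_integral_mono ennreal_leI mult_left_le_one_le) (auto simp: h)
    also note hA
    finally show ?thesis .
  qed
  then have Jfin: "J x = ennreal (enn2real (J x))" for x
    by (metis ennreal_enn2real ennreal_less_top le_less_trans)
  have jA: "enn2real (J x) \<le> A powr r" for x
    using JA[of x] by (simp add: enn2real_leI)
  have H: "H x \<le> ennreal (G powr (1 - 1/r) * enn2real (J x) powr (1/r))" if x: "x \<in> space M" for x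
    unfolding H_def
  proof (rule Hoelder_weighted)
    show "k x \<in> borel_measurable M" using x by measurable
    show "(\<integral>\<^sup>+y. ennreal (k x y) \<partial>M) \<le> ennreal G" by (rule G(2)[OF x])
    show "(\<integral>\<^sup>+y. ennreal (k x y * h y powr r) \<partial>M) \<le> ennreal (enn2real (J x))"
      using Jfin[of x] by (metis J_def order_refl)
  qed (use h k r G in auto)
  have HA: "G powr (1 - 1/r) * enn2real (J x) powr (1/r) \<le> G powr (1 - 1/r) * A" for x
  proof -
    have "enn2real (J x) powr (1/r) \<le> (A powr r) powr (1/r)"
      using jA r by (intro powr_mono2) auto
    then show ?thesis using A r by (intro mult_left_mono) (auto simp: powr_powr)
  qed
  show "H x \<le> ennreal (G powr (1 - 1/r) * A)" if "x \<in> space M"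
    using H[OF that] HA[of x] by (meson ennreal_leI order_trans)
  define c where "c = (G powr (1 - 1/r) * A) powr (s - r) * G powr (r - 1)"
  have pw: "enn2real (H x) powr s \<le> c * enn2real (J x)" if x: "x \<in> space M" for x
  proof -
    let ?v = "enn2real (H x)"
    have v: "?v \<le> G powr (1 - 1/r) * enn2real (J x) powr (1/r)"
      using H[OF x] G by (intro enn2real_leI) auto
    then have v2: "?v \<le> G powr (1 - 1/r) * A" using HA[of x] by simp
    have "?v powr r \<le> (G powr (1 - 1/r) * enn2real (J x) powr (1/r)) powr r"
      using v r by (intro powr_mono2) auto
    also have "\<dots> = G powr (r - 1) * enn2real (J x)"
      using r by (simp add: powr_mult powr_powr algebra_simps)
    finally have 1: "?v powr r \<le> G powr (r - 1) * enn2real (J x)" .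
    have 2: "?v powr (s - r) \<le> (G powr (1 - 1/r) * A) powr (s - r)"
      using v2 s by (intro powr_mono2) auto
    have "?v powr s = ?v powr (s - r) * ?v powr r" by (simp add: powr_add[symmetric])
    also have "\<dots> \<le> (G powr (1 - 1/r) * A) powr (s - r) * (G powr (r - 1) * enn2real (J x))"
      by (intro mult_mono 1 2) auto
    finally show ?thesis by (simp add: c_def)
  qed
  have c: "c \<ge> 0" by (simp add: c_def)
  have "(\<integral>\<^sup>+x. ennreal (enn2real (H x) powr s) \<partial>M) \<le> (\<integral>\<^sup>+x. ennreal c * J x \<partial>M)"
    by (intro nn_integral_mono, subst Jfin) (use pw c in \<open>simp add: ennreal_mult'[symmetric] ennreal_leI\<close>)
  also have "\<dots> = ennreal c * (\<integral>\<^sup>+x. J x \<partial>M)"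
    by (rule nn_integral_cmult) measurable
  finally have HJ: "(\<integral>\<^sup>+x. ennreal (enn2real (H x) powr s) \<partial>M) \<le> ennreal c * (\<integral>\<^sup>+x. J x \<partial>M)" .
  have "(\<integral>\<^sup>+x. J x \<partial>M)
      = (\<integral>\<^sup>+y. (\<integral>\<^sup>+x. ennreal (k x y * h y powr r) \<partial>M) \<partial>M)"
    unfolding J_def
    by (rule P.Fubini'[where f = "\<lambda>x y. ennreal (k x y * h y powr r)", symmetric]) measurable
  also have "\<dots> \<le> (\<integral>\<^sup>+y. ennreal G * ennreal (h y powr r) \<partial>M)"
  proof (rule nn_integral_mono)
    fix y assume y: "y \<in> space M"
    have "(\<integral>\<^sup>+x. ennreal (k x y * h y powr r) \<partial>M)
       = (\<integral>\<^sup>+x. ennreal (k y x) * ennreal (h y powr r) \<partial>M)"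
      by (subst k(3)) (simp add: ennreal_mult' k(1))
    also have "\<dots> = (\<integral>\<^sup>+x. ennreal (k y x) \<partial>M) * ennreal (h y powr r)"
      using y by (intro nn_integral_multc) measurable
    also have "\<dots> \<le> ennreal G * ennreal (h y powr r)"
      by (intro mult_right_mono G(2) y) simp
    finally show "(\<integral>\<^sup>+x. ennreal (k x y * h y powr r) \<partial>M)
       \<le> ennreal G * ennreal (h y powr r)" .
  qed
  also have "\<dots> = ennreal G * (\<integral>\<^sup>+y. ennreal (h y powr r) \<partial>M)"
    by (rule nn_integral_cmult) measurable
  also have "\<dots> \<le> ennreal G * ennreal (A powr r)"
    by (intro mult_left_mono hA) auto
  finally have J_total: "(\<integral>\<^sup>+x. J x \<partial>M) \<le> ennreal G * ennreal (A powr r)" .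
  note HJ
  also have "ennreal c * (\<integral>\<^sup>+x. J x \<partial>M) \<le> ennreal c * (ennreal G * ennreal (A powr r))"
    by (intro mult_left_mono J_total) auto
  also have "ennreal c * (ennreal G * ennreal (A powr r)) = ennreal (c * G * A powr r)"
    using c G by (simp add: ennreal_mult'[symmetric] mult_ac)
  also have "c * G * A powr r = G powr (s + 1 - s/r) * A powr s"
  proof -
    have "c = G powr ((1 - 1/r) * (s - r)) * A powr (s - r) * G powr (r - 1)"
      using G A by (simp add: c_def powr_mult powr_powr)
    then have "c * G * A powr r
        = (G powr ((1 - 1/r) * (s - r)) * G powr (r - 1) * G powr 1) * (A powr (s - r) * A powr r)"
      using G by simp
    also have "\<dots> = G powr ((1 - 1/r) * (s - r) + (r - 1) + 1) * A powr s"
      by (simp only: powr_add[symmetric]) simp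
    also have "(1 - 1/r) * (s - r) + (r - 1) + 1 = s + 1 - s/r"
      using r by (simp add: field_simps)
    finally show ?thesis .
  qed
  finally show "(\<integral>\<^sup>+x. ennreal (enn2real (H x) powr s) \<partial>M)
      \<le> ennreal (G powr (s + 1 - s/r) * A powr s)" .
qed

definition gauss :: "real \<Rightarrow> 'a::euclidean_space \<Rightarrow> 'a \<Rightarrow> real" where
  "gauss t x y = exp (- ((norm (x - y))\<^sup>2 / (4 * t)))"

lemma gauss_commute: "gauss t x y = gauss t y x"
  by (simp add: gauss_def norm_minus_commute)

lemma gauss_nonneg [simp]: "0 \<le> gauss t x y"
  by (simp add: gauss_def)

lemma gauss_le_1: "0 < t \<Longrightarrow> gauss t x y \<le> 1"
  by (simp add: gauss_def)

lemma gauss_measurable_pair: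
  "(\<lambda>(x, y). gauss t x y) \<in> borel_measurable (lebesgue \<Otimes>\<^sub>M lebesgue)"
proof -
  have id: "(\<lambda>x. x) \<in> borel_measurable (lebesgue :: 'a measure)"
    by (intro measurable_completion) simp
  have [measurable]: "fst \<in> borel_measurable (lebesgue \<Otimes>\<^sub>M lebesgue :: ('a \<times> 'a) measure)"
      "snd \<in> borel_measurable (lebesgue \<Otimes>\<^sub>M lebesgue :: ('a \<times> 'a) measure)"
    using measurable_comp[OF measurable_fst id] measurable_comp[OF measurable_snd id]
    by (simp_all add: comp_def)
  show ?thesis unfolding gauss_def case_prod_beta by measurable
qed

lemma gauss_measurable [measurable]: "gauss t x \<in> borel_measurable lebesgue"
  unfolding gauss_def by (intro measurable_completion) measurable

text \<open>
  The kernel is a product over the coordinates of multiples of normal densities with variance $2t$.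
\<close>

lemma nn_integral_gauss:
  fixes x :: "'a::euclidean_space"
  assumes t: "0 < t"
  shows "(\<integral>\<^sup>+y. ennreal (gauss t x y) \<partial>lebesgue) = ennreal (sqrt ((4 * pi * t) ^ DIM('a)))"
proof -
  let ?f = "\<lambda>b u. exp (- ((x \<bullet> b - u)\<^sup>2 / (4 * t)))"
  have "gauss t x y = (\<Prod>b\<in>Basis. ?f b (y \<bullet> b))" for y
  proof -
    have "(norm (x - y))\<^sup>2 = (\<Sum>b\<in>Basis. (x \<bullet> b - y \<bullet> b)\<^sup>2)"
      by (subst power2_norm_eq_inner, subst euclidean_inner) (simp add: inner_diff_left power2_eq_square)
    then show ?thesis
      by (simp add: gauss_def exp_sum[symmetric] sum_divide_distrib sum_negf)
  qed
  then have "(\<integral>\<^sup>+y. ennreal (gauss t x y) \<partial>lebesgue)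
      = (\<integral>\<^sup>+y. ennreal (\<Prod>b\<in>Basis. ?f b (y \<bullet> b)) \<partial>lborel)"
    by (simp add: nn_integral_completion)
  also have "\<dots> = (\<Prod>b\<in>(Basis::'a set). (\<integral>\<^sup>+u. ennreal (?f b u) \<partial>lborel))"
    by (subst prod_ennreal[symmetric]) (auto intro!: nn_integral_lborel_prod)
  also have "\<dots> = (\<Prod>b\<in>(Basis::'a set). ennreal (sqrt (4 * pi * t)))"
  proof (rule prod.cong)
    fix b :: 'a
    have "?f b u = sqrt (4 * pi * t) * normal_density (x \<bullet> b) (sqrt (2 * t)) u" for u
      using t by (simp add: normal_density_def power2_commute mult.assoc)
    then have "(\<integral>\<^sup>+u. ennreal (?f b u) \<partial>lborel)
       = ennreal (sqrt (4 * pi * t)) * (\<integral>\<^sup>+u. ennreal (normal_density (x \<bullet> b) (sqrt (2 * t)) u) \<partial>lborel)"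
      using t by (simp add: ennreal_mult' nn_integral_cmult)
    also have "(\<integral>\<^sup>+u. ennreal (normal_density (x \<bullet> b) (sqrt (2 * t)) u) \<partial>lborel) = 1"
      using t by (subst nn_integral_eq_integral) auto
    finally show "(\<integral>\<^sup>+u. ennreal (?f b u) \<partial>lborel) = ennreal (sqrt (4 * pi * t))" by simp
  qed simp
  also have "\<dots> = ennreal (sqrt ((4 * pi * t) ^ DIM('a)))"
    using t by (simp add: ennreal_power real_sqrt_power)
  finally show ?thesis .
qed

section \<open>Power weights and functions of power growth on balls\<close>

text \<open>
  On the shell $r_k \le |y| < 2 r_k$ the weight $|y|^{-a}$ is at most $r_k^{-a}$, and the growth hypothesis on
  the ball of radius $2 r_k$ bounds the integral of $F$ over the shell by $A (2 r_k)^d$. Near the origin and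
  near infinity the same sum appears, only with shrinking respectively growing radii $r_k$.
\<close>

lemma nn_integral_shells:
  fixes F :: "'a::euclidean_space \<Rightarrow> real" and r :: "nat \<Rightarrow> real"
  assumes F_meas: "F \<in> borel_measurable lebesgue"
    and F: "\<And>y. 0 \<le> F y" and a: "0 \<le> a" and A: "0 \<le> A"
    and growth: "\<And>\<rho>. 0 < \<rho> \<Longrightarrow>
      (\<integral>\<^sup>+y. ennreal (F y) * indicator (ball 0 \<rho>) y \<partial>lebesgue) \<le> ennreal (A * \<rho> powr d)"
    and r: "\<And>k. 0 < r k"
    and shells: "\<And>y. y \<in> S \<Longrightarrow> y \<noteq> 0 \<Longrightarrow> \<exists>k. r k \<le> norm y \<and> norm y < 2 * r k"
    and L: "(\<lambda>k. r k powr (d - a)) sums L"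
  shows "(\<integral>\<^sup>+y. ennreal (norm y powr (-a) * F y) * indicator S y \<partial>lebesgue)
      \<le> ennreal (A * 2 powr d * L)"
proof -
  let ?T = "\<lambda>k y. ennreal (r k powr (-a)) * (ennreal (F y) * indicator (ball 0 (2 * r k)) y)"
  have B: "(\<lambda>y. ennreal (F y) * indicator (ball 0 \<rho>) y) \<in> borel_measurable lebesgue" for \<rho>
    by (intro borel_measurable_times_ennreal borel_measurable_indicator measurable_compose[OF F_meas]) auto
  have "(\<integral>\<^sup>+y. ennreal (norm y powr (-a) * F y) * indicator S y \<partial>lebesgue)
      \<le> (\<integral>\<^sup>+y. (\<Sum>k. ?T k y) \<partial>lebesgue)"
  proof (rule nn_integral_mono)
    fix y :: 'a
    show "ennreal (norm y powr (-a) * F y) * indicator S y \<le> (\<Sum>k. ?T k y)"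
    proof (cases "y \<in> S \<and> y \<noteq> 0")
      case True
      then obtain k where k: "r k \<le> norm y" "norm y < 2 * r k" using shells by blast
      have "norm y powr (-a) \<le> r k powr (-a)"
        using k r[of k] a by (intro powr_mono2') auto
      then have "ennreal (norm y powr (-a) * F y) * indicator S y \<le> ?T k y"
        using True k F[of y]
        by (simp add: ennreal_mult'[symmetric] ennreal_leI mult_right_mono)
      also have "\<dots> \<le> (\<Sum>k. ?T k y)"
        using sum_le_suminf[of "\<lambda>k. ?T k y" "{k}"] by simp
      finally show ?thesis .
    qed auto
  qed
  also have "\<dots> = (\<Sum>k. \<integral>\<^sup>+y. ?T k y \<partial>lebesgue)"
    by (intro nn_integral_suminf borel_measurable_times_ennreal borel_measurable_const B)
  also have "\<dots> \<le> (\<Sum>k. ennreal (A * 2 powr d * r k powr (d - a)))"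
  proof (rule suminf_le)
    fix k
    have "(\<integral>\<^sup>+y. ?T k y \<partial>lebesgue)
        = ennreal (r k powr (-a)) * (\<integral>\<^sup>+y. ennreal (F y) * indicator (ball 0 (2 * r k)) y \<partial>lebesgue)"
      by (intro nn_integral_cmult B)
    also have "\<dots> \<le> ennreal (r k powr (-a)) * ennreal (A * (2 * r k) powr d)"
      using r[of k] by (intro mult_left_mono growth) auto
    also have "\<dots> = ennreal (A * 2 powr d * r k powr (d - a))"
      using r[of k] by (simp add: ennreal_mult'[symmetric] powr_mult powr_diff powr_minus field_simps)
    finally show "(\<integral>\<^sup>+y. ?T k y \<partial>lebesgue) \<le> ennreal (A * 2 powr d * r k powr (d - a))" .
  qed auto
  also have "\<dots> = ennreal (A * 2 powr d * L)"
    using sums_mult[OF L, of "A * 2 powr d"] A by (intro suminf_ennreal_eq) auto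
  finally show ?thesis .
qed

lemma powr_geometric:
  fixes b c e :: real
  assumes "0 < b" "0 < c"
  shows "(c * b ^ k) powr e = c powr e * (b powr e) ^ k"
proof -
  have "(b ^ k) powr e = (b powr e) ^ k"
    using assms by (induction k) (auto simp: powr_mult)
  then show ?thesis using assms by (simp add: powr_mult)
qed

lemma nn_integral_weight_ball:
  fixes F :: "'a::euclidean_space \<Rightarrow> real"
  assumes F: "F \<in> borel_measurable lebesgue" "\<And>y. 0 \<le> F y" and a: "0 \<le> a" and A: "0 \<le> A"
    and growth: "\<And>\<rho>. 0 < \<rho> \<Longrightarrow>
      (\<integral>\<^sup>+y. ennreal (F y) * indicator (ball 0 \<rho>) y \<partial>lebesgue) \<le> ennreal (A * \<rho> powr d)"
    and "a < d" and R: "0 < R"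
  shows "(\<integral>\<^sup>+y. ennreal (norm y powr (-a) * F y) * indicator (ball 0 R) y \<partial>lebesgue)
      \<le> ennreal (A * 2 powr d * ((R/2) powr (d - a) * (1 / (1 - (1/2) powr (d - a)))))"
proof (rule nn_integral_shells[where r = "\<lambda>k. R/2 * (1/2)^k"])
  \<comment> \<open>The first dyadic radius not exceeding $|y|$ is the inner radius of the shell of $y$.\<close>
  fix y :: 'a assume y: "y \<in> ball 0 R" "y \<noteq> 0"
  define m where "m = (LEAST n. R * (1/2)^n \<le> norm y)"
  obtain n where "(1/2)^n < norm y / R"
    using real_arch_pow_inv[of "norm y / R" "1/2"] y R by auto
  then have "R * (1/2)^n \<le> norm y" using R by (simp add: field_simps)
  then have m: "R * (1/2)^m \<le> norm y" unfolding m_def by (rule LeastI)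
  then have "m \<noteq> 0" using y by (intro notI) simp
  then obtain k where k: "m = Suc k" by (cases m) auto
  then have "\<not> R * (1/2)^k \<le> norm y" unfolding m_def by (metis lessI not_less_Least)
  with m k show "\<exists>k. R/2 * (1/2)^k \<le> norm y \<and> norm y < 2 * (R/2 * (1/2)^k)"
    by (intro exI[of _ k]) simp
next
  have "(R/2 * (1/2)^k) powr (d - a) = (R/2) powr (d - a) * ((1/2) powr (d - a))^k" for k :: nat
    using R by (intro powr_geometric) auto
  moreover have "(1/2::real) powr (d - a) < 1" using \<open>a < d\<close> by (simp add: powr_divide gr_one_powr)
  ultimately show "(\<lambda>k. (R/2 * (1/2)^k) powr (d - a)) sums ((R/2) powr (d - a) * (1 / (1 - (1/2) powr (d - a))))"
    using R by (simp only:) (intro sums_mult geometric_sums, simp)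
qed (use assms in auto)

lemma nn_integral_weight_outside_ball:
  fixes F :: "'a::euclidean_space \<Rightarrow> real"
  assumes F: "F \<in> borel_measurable lebesgue" "\<And>y. 0 \<le> F y" and a: "0 \<le> a" and A: "0 \<le> A"
    and growth: "\<And>\<rho>. 0 < \<rho> \<Longrightarrow>
      (\<integral>\<^sup>+y. ennreal (F y) * indicator (ball 0 \<rho>) y \<partial>lebesgue) \<le> ennreal (A * \<rho> powr d)"
    and "d < a" and R: "0 < R"
  shows "(\<integral>\<^sup>+y. ennreal (norm y powr (-a) * F y) * indicator (- ball 0 R) y \<partial>lebesgue)
      \<le> ennreal (A * 2 powr d * (R powr (d - a) * (1 / (1 - 2 powr (d - a)))))"
proof (rule nn_integral_shells[where r = "\<lambda>k. R * 2^k"])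
  \<comment> \<open>The first dyadic radius exceeding $|y|$ is the outer radius of the shell of $y$.\<close>
  fix y :: 'a assume y: "y \<in> - ball 0 R" "y \<noteq> 0"
  define m where "m = (LEAST n. norm y < R * 2^n)"
  obtain n where "norm y / R < 2^n"
    using real_arch_pow[of 2 "norm y / R"] by auto
  then have "norm y < R * 2^n" using R by (simp add: field_simps)
  then have m: "norm y < R * 2^m" unfolding m_def by (rule LeastI)
  then have "m \<noteq> 0" using y by (intro notI) simp
  then obtain k where k: "m = Suc k" by (cases m) auto
  then have "\<not> norm y < R * 2^k" unfolding m_def by (metis lessI not_less_Least)
  with m k show "\<exists>k. R * 2^k \<le> norm y \<and> norm y < 2 * (R * 2^k)"
    by (intro exI[of _ k]) simp
next
  have "(R * 2^k) powr (d - a) = R powr (d - a) * (2 powr (d - a))^k" for k :: nat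
    using R by (intro powr_geometric) auto
  moreover have "(2::real) powr (d - a) < 1" using \<open>d < a\<close> by (simp add: powr_less_one)
  ultimately show "(\<lambda>k. (R * 2^k) powr (d - a)) sums (R powr (d - a) * (1 / (1 - 2 powr (d - a))))"
    using R by (simp only:) (intro sums_mult geometric_sums, simp)
qed (use assms in auto)

section \<open>Morrey functions on balls\<close>

lemma morrey_norm_ball:
  fixes f :: "real ^ 'n \<Rightarrow> complex"
  defines "N \<equiv> real CARD('n)"
  assumes M: "morrey_norm p q f = ennreal M" "0 \<le> M" and q: "0 < q" and \<rho>: "0 < \<rho>"
  shows "(\<integral>\<^sup>+y. ennreal (norm (f y) powr q) * indicator (ball x \<rho>) y \<partial>lebesgue)
      \<le> ennreal (M powr q * \<rho> powr (N - N * q / p))"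
proof -
  let ?I = "\<integral>\<^sup>+y. ennreal (norm (f y) powr q) * indicator (ball x \<rho>) y \<partial>lebesgue"
  define e where "e = N / p - N / q"
  have "ennreal (\<rho> powr e) * ennroot q ?I \<le> morrey_norm p q f"
    unfolding morrey_norm_def e_def N_def
    using \<rho> by (intro SUP_upper2[of "(x, \<rho>)"]) auto
  then have "ennreal (\<rho> powr (-e)) * (ennreal (\<rho> powr e) * ennroot q ?I) \<le> ennreal (\<rho> powr (-e)) * ennreal M"
    unfolding M by (rule mult_left_mono) simp
  moreover have "ennreal (\<rho> powr (-e)) * ennreal (\<rho> powr e) = 1"
    using \<rho> by (simp add: powr_minus flip: ennreal_mult')
  ultimately have "ennroot q ?I \<le> ennreal (\<rho> powr (-e) * M)"
    using M by (simp add: mult.assoc[symmetric] ennreal_mult')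
  from le_of_ennroot_le[OF this q] have "?I \<le> ennreal ((\<rho> powr (-e) * M) powr q)" .
  also have "(\<rho> powr (-e) * M) powr q = M powr q * \<rho> powr (N - N * q / p)"
  proof -
    have "- e * q = N - N * q / p" using q by (simp add: e_def field_simps)
    then show ?thesis using M by (simp add: powr_mult powr_powr mult.commute)
  qed
  finally show ?thesis .
qed

text \<open>
  Hoelder's inequality with the indicator of the ball as weight trades the $q$-th power growth of the
  previous lemma for growth in $L^1$, at the cost of the factor $|B(x,\rho)|^{1-1/q}$.
\<close>

lemma morrey_norm_ball_L1:
  fixes f :: "real ^ 'n \<Rightarrow> complex"
  defines "N \<equiv> real CARD('n)"
  assumes f: "f \<in> borel_measurable lebesgue"
    and M: "morrey_norm p q f = ennreal M" "0 \<le> M" and q: "1 \<le> q" and \<rho>: "0 < \<rho>"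
  shows "(\<integral>\<^sup>+y. ennreal (norm (f y)) * indicator (ball x \<rho>) y \<partial>lebesgue)
      \<le> ennreal (unit_ball_vol N powr (1 - 1/q) * M * \<rho> powr (N - N / p))"
proof -
  let ?w = "indicator (ball x \<rho>) :: real ^ 'n \<Rightarrow> real"
  let ?W = "unit_ball_vol N * \<rho> powr N"
  have V: "unit_ball_vol N > 0" by (simp add: N_def)
  have "(\<integral>\<^sup>+y. ennreal (?w y * norm (f y)) \<partial>lebesgue)
      \<le> ennreal (?W powr (1 - 1/q) * (M powr q * \<rho> powr (N - N * q / p)) powr (1/q))"
  proof (rule Hoelder_weighted)
    show "(\<lambda>y. norm (f y)) \<in> borel_measurable lebesgue"
      using f by (rule measurable_compose) simp
    have "(\<integral>\<^sup>+y. ennreal (?w y) \<partial>lebesgue) = emeasure lebesgue (ball x \<rho>)"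
      by (simp add: ennreal_indicator)
    also have "\<dots> = ennreal ?W"
      using \<rho> emeasure_ball[of \<rho> x] by (simp add: N_def powr_realpow)
    finally show "(\<integral>\<^sup>+y. ennreal (?w y) \<partial>lebesgue) \<le> ennreal ?W" by simp
    have "(\<integral>\<^sup>+y. ennreal (?w y * norm (f y) powr q) \<partial>lebesgue)
        = (\<integral>\<^sup>+y. ennreal (norm (f y) powr q) * indicator (ball x \<rho>) y \<partial>lebesgue)"
      by (intro nn_integral_cong) (simp add: indicator_def)
    also have "\<dots> \<le> ennreal (M powr q * \<rho> powr (N - N * q / p))"
      unfolding N_def using M q \<rho> by (intro morrey_norm_ball) auto
    finally show "(\<integral>\<^sup>+y. ennreal (?w y * norm (f y) powr q) \<partial>lebesgue)
        \<le> ennreal (M powr q * \<rho> powr (N - N * q / p))" .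
  qed (use q \<rho> V in \<open>auto intro!: borel_measurable_indicator\<close>)
  also have "?W powr (1 - 1/q) * (M powr q * \<rho> powr (N - N * q / p)) powr (1/q)
      = unit_ball_vol N powr (1 - 1/q) * M * \<rho> powr (N - N / p)"
  proof -
    have "?W powr (1 - 1/q) = unit_ball_vol N powr (1 - 1/q) * \<rho> powr (N * (1 - 1/q))"
      using V by (simp add: powr_mult powr_powr)
    moreover have "(M powr q * \<rho> powr (N - N * q / p)) powr (1/q) = M * \<rho> powr ((N - N * q / p) * (1/q))"
      using M q by (simp add: powr_mult powr_powr)
    moreover have "N * (1 - 1/q) + (N - N * q / p) * (1/q) = N - N / p"
      using q by (simp add: field_simps)
    ultimately show ?thesis by (simp add: powr_add[symmetric])
  qed
  also have "(\<integral>\<^sup>+y. ennreal (?w y * norm (f y)) \<partial>lebesgue)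
      = (\<integral>\<^sup>+y. ennreal (norm (f y)) * indicator (ball x \<rho>) y \<partial>lebesgue)"
    by (intro nn_integral_cong) (simp add: indicator_def)
  finally show ?thesis .
qed

section \<open>The heat semigroup on functions split into an integrable and a $q$-integrable part\<close>

lemma powr_add_le:
  fixes a b s :: real
  assumes "0 \<le> a" "0 \<le> b" "0 \<le> s"
  shows "(a + b) powr s \<le> 2 powr s * (a powr s + b powr s)"
proof -
  have "(a + b) powr s \<le> (2 * max a b) powr s" using assms by (intro powr_mono2) auto
  also have "\<dots> = 2 powr s * max a b powr s" using assms by (simp add: powr_mult)
  also have "\<dots> \<le> 2 powr s * (a powr s + b powr s)"
    by (intro mult_left_mono) (auto simp: max_def)
  finally show ?thesis .
qed

text \<open>
  The part of $g$ on $B$ is smoothed from $L^1$ to $L^s$ and the part outside $B$ from $L^q$ to $L^s$. The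
  sup bounds of the smoothing lemma make the heat integral converge absolutely at every point. As $G$
  is the total mass of the Gaussian, division by it turns the exponent $s + 1 - s/r$ of $G$ into $1 - s/r$, that is,
  into $s$ times $1/s - 1/r$, for $r = 1$ and $r = q$.
\<close>

lemma heat_split_bound:
  fixes g :: "real ^ 'n \<Rightarrow> complex" and t q s A1 A2 :: real
  defines "G \<equiv> sqrt ((4 * pi * t) ^ CARD('n))"
  assumes g: "g \<in> borel_measurable lebesgue" and B: "B \<in> sets lebesgue"
    and t: "0 < t" and q: "1 \<le> q" and s: "q \<le> s" and A: "0 \<le> A1" "0 \<le> A2"
    and A1: "(\<integral>\<^sup>+y. ennreal (norm (g y)) * indicator B y \<partial>lebesgue) \<le> ennreal A1"
    and A2: "(\<integral>\<^sup>+y. ennreal (norm (g y) powr q) * indicator (- B) y \<partial>lebesgue) \<le> ennreal (A2 powr q)"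
  shows "heat_defined t g" and "heat t g \<in> borel_measurable lebesgue"
    and "(\<integral>\<^sup>+x. ennreal (norm (heat t g x) powr s) \<partial>lebesgue)
      \<le> ennreal (2 powr s * ((G powr (1/s - 1) * A1) powr s + (G powr (1/s - 1/q) * A2) powr s))"
proof -
  interpret L: sigma_finite_measure "lebesgue :: (real ^ 'n) measure" by (rule sigma_finite_lebesgue)
  have G: "G > 0" using t by (simp add: G_def)
  have s1: "1 \<le> s" using q s by simp
  define h1 where "h1 = (\<lambda>y. norm (g y) * indicator B y)"
  define h2 where "h2 = (\<lambda>y. norm (g y) * indicator (- B) y)"
  have gn: "(\<lambda>y. norm (g y)) \<in> borel_measurable lebesgue"
    using g by (rule measurable_compose) simp
  have Bc: "- B \<in> sets lebesgue"
    using sets.compl_sets[OF B] by (simp add: Compl_eq_Diff_UNIV)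
  have h1_meas: "h1 \<in> borel_measurable lebesgue" and h2_meas: "h2 \<in> borel_measurable lebesgue"
    unfolding h1_def h2_def using B Bc
    by (auto intro!: borel_measurable_times gn borel_measurable_indicator)
  have nn: "0 \<le> h1 y" "0 \<le> h2 y" for y by (simp_all add: h1_def h2_def)
  define H1 where "H1 = (\<lambda>x. \<integral>\<^sup>+y. ennreal (gauss t x y * h1 y) \<partial>lebesgue)"
  define H2 where "H2 = (\<lambda>x. \<integral>\<^sup>+y. ennreal (gauss t x y * h2 y) \<partial>lebesgue)"
  have kernel: "0 \<le> gauss t x y" "gauss t x y \<le> 1" "gauss t x y = gauss t y x"
    "(\<integral>\<^sup>+y. ennreal (gauss t x y) \<partial>lebesgue) \<le> ennreal G" for x y :: "real ^ 'n"
    using t by (auto simp: gauss_le_1 nn_integral_gauss G_def intro: gauss_commute)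
  have "(\<integral>\<^sup>+y. ennreal (h1 y powr 1) \<partial>lebesgue) = (\<integral>\<^sup>+y. ennreal (norm (g y)) * indicator B y \<partial>lebesgue)"
    by (intro nn_integral_cong) (simp add: h1_def indicator_def)
  then have A1': "(\<integral>\<^sup>+y. ennreal (h1 y powr 1) \<partial>lebesgue) \<le> ennreal (A1 powr 1)"
    using A1 A by simp
  have "(\<integral>\<^sup>+y. ennreal (h2 y powr q) \<partial>lebesgue)
      = (\<integral>\<^sup>+y. ennreal (norm (g y) powr q) * indicator (- B) y \<partial>lebesgue)"
    by (intro nn_integral_cong) (simp add: h2_def indicator_def)
  then have A2': "(\<integral>\<^sup>+y. ennreal (h2 y powr q) \<partial>lebesgue) \<le> ennreal (A2 powr q)"
    using A2 by simp
  note smoothing = symmetric_kernel_smoothing[OF sigma_finite_lebesgue gauss_measurable_pair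
    kernel(1) kernel(2) kernel(3) G kernel(4), folded H1_def H2_def]
  have H1_fin: "H1 x \<le> ennreal (G powr (1 - 1/1) * A1)" for x
    unfolding H1_def by (rule smoothing(1)[OF h1_meas nn(1) order_refl s1 A(1) A1']) simp
  have H2_fin: "H2 x \<le> ennreal (G powr (1 - 1/q) * A2)" for x
    unfolding H2_def by (rule smoothing(1)[OF h2_meas nn(2) q s A(2) A2']) simp
  have H1_s: "(\<integral>\<^sup>+x. ennreal (enn2real (H1 x) powr s) \<partial>lebesgue) \<le> ennreal (G powr (s + 1 - s/1) * A1 powr s)"
    unfolding H1_def by (rule smoothing(2)[OF h1_meas nn(1) order_refl s1 A(1) A1'])
  have H2_s: "(\<integral>\<^sup>+x. ennreal (enn2real (H2 x) powr s) \<partial>lebesgue) \<le> ennreal (G powr (s + 1 - s/q) * A2 powr s)"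
    unfolding H2_def by (rule smoothing(2)[OF h2_meas nn(2) q s A(2) A2'])
  have H1_eq: "H1 x = ennreal (enn2real (H1 x))" and H2_eq: "H2 x = ennreal (enn2real (H2 x))" for x
    using H1_fin[of x] H2_fin[of x] by (metis ennreal_enn2real ennreal_less_top le_less_trans)+
  have norm_integrand: "norm (heat_integrand t g x y) = gauss t x y * h1 y + gauss t x y * h2 y" for x y
    by (simp add: heat_integrand_def gauss_def h1_def h2_def indicator_def)
  have pair_meas: "(\<lambda>(x, y). heat_integrand t g x y) \<in> borel_measurable (lebesgue \<Otimes>\<^sub>M lebesgue)"
  proof -
    have "(\<lambda>z. gauss t (fst z) (snd z) *\<^sub>R g (snd z)) \<in> borel_measurable (lebesgue \<Otimes>\<^sub>M lebesgue)"
      using gauss_measurable_pair[of t, where 'a="real^'n"]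
      by (intro borel_measurable_scaleR measurable_compose[OF measurable_snd g]) (simp add: case_prod_beta')
    then show ?thesis by (simp add: heat_integrand_def gauss_def case_prod_beta')
  qed
  have integrand_meas: "heat_integrand t g x \<in> borel_measurable lebesgue" for x
    using measurable_Pair2[OF pair_meas, of x] by simp
  have gauss_h_meas: "(\<lambda>y. ennreal (gauss t x y * h y)) \<in> borel_measurable lebesgue"
    if "h \<in> borel_measurable lebesgue" for x :: "real ^ 'n" and h
    using that by (intro measurable_compose[OF _ measurable_ennreal] borel_measurable_times gauss_measurable)
  have H_sum: "(\<integral>\<^sup>+y. ennreal (norm (heat_integrand t g x y)) \<partial>lebesgue) = H1 x + H2 x" for x
  proof -
    have "H1 x + H2 x = (\<integral>\<^sup>+y. ennreal (gauss t x y * h1 y) + ennreal (gauss t x y * h2 y) \<partial>lebesgue)"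
      unfolding H1_def H2_def by (intro nn_integral_add[symmetric] gauss_h_meas h1_meas h2_meas)
    then show ?thesis by (simp add: norm_integrand nn)
  qed
  show defined: "heat_defined t g"
    unfolding heat_defined_def integrable_iff_bounded H_sum
    using integrand_meas by (subst H1_eq, subst H2_eq) (simp add: less_top[symmetric])
  show meas: "heat t g \<in> borel_measurable lebesgue"
    unfolding heat_def[abs_def]
    by (intro borel_measurable_scaleR borel_measurable_const L.borel_measurable_lebesgue_integral pair_meas)
  have H_meas: "(\<lambda>x. \<integral>\<^sup>+y. ennreal (gauss t x y * h y) \<partial>lebesgue) \<in> borel_measurable lebesgue"
    if "h \<in> borel_measurable lebesgue" for h :: "real ^ 'n \<Rightarrow> real"
  proof (rule L.borel_measurable_nn_integral)
    have "(\<lambda>z. ennreal (gauss t (fst z) (snd z) * h (snd z))) \<in> borel_measurable (lebesgue \<Otimes>\<^sub>M lebesgue)"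
      using gauss_measurable_pair[of t, where 'a="real^'n"]
      by (intro measurable_compose[OF _ measurable_ennreal] borel_measurable_times
          measurable_compose[OF measurable_snd that]) (simp add: case_prod_beta')
    then show "(\<lambda>(x, y). ennreal (gauss t x y * h y)) \<in> borel_measurable (lebesgue \<Otimes>\<^sub>M lebesgue)"
      by (simp add: case_prod_beta')
  qed
  have powr_meas: "(\<lambda>x. ennreal (enn2real (f x) powr s)) \<in> borel_measurable M"
    if "f \<in> borel_measurable M" for f :: "real ^ 'n \<Rightarrow> ennreal" and M
    using that by measurable
  have pw: "norm (heat t g x) powr s
      \<le> 2 powr s * G powr (- s) * (enn2real (H1 x) powr s + enn2real (H2 x) powr s)" for x
  proof -
    have "ennreal (norm (\<integral>y. heat_integrand t g x y \<partial>lebesgue)) \<le> H1 x + H2 x"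
      using defined unfolding heat_defined_def H_sum[symmetric] by (intro integral_norm_bound_ennreal) simp
    also have "\<dots> = ennreal (enn2real (H1 x) + enn2real (H2 x))"
      by (subst H1_eq, subst H2_eq) simp
    finally have "norm (\<integral>y. heat_integrand t g x y \<partial>lebesgue) \<le> enn2real (H1 x) + enn2real (H2 x)"
      by (subst (asm) ennreal_le_iff) auto
    then have "norm (heat t g x) \<le> (enn2real (H1 x) + enn2real (H2 x)) / G"
      using G by (simp add: heat_def G_def[symmetric] divide_right_mono)
    then have "norm (heat t g x) powr s \<le> ((enn2real (H1 x) + enn2real (H2 x)) / G) powr s"
      using s1 by (intro powr_mono2) auto
    also have "\<dots> = G powr (- s) * (enn2real (H1 x) + enn2real (H2 x)) powr s"
      using G by (simp add: powr_divide powr_minus field_simps)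
    also have "\<dots> \<le> G powr (- s) * (2 powr s * (enn2real (H1 x) powr s + enn2real (H2 x) powr s))"
      using s1 by (intro mult_left_mono powr_add_le) auto
    finally show ?thesis by (simp add: mult_ac)
  qed
  define c where "c = 2 powr s * G powr (- s)"
  have "(\<integral>\<^sup>+x. ennreal (norm (heat t g x) powr s) \<partial>lebesgue)
      \<le> (\<integral>\<^sup>+x. ennreal c * (ennreal (enn2real (H1 x) powr s) + ennreal (enn2real (H2 x) powr s)) \<partial>lebesgue)"
  proof (rule nn_integral_mono)
    fix x
    show "ennreal (norm (heat t g x) powr s)
        \<le> ennreal c * (ennreal (enn2real (H1 x) powr s) + ennreal (enn2real (H2 x) powr s))"
      using ennreal_leI[OF pw[of x]] by (simp add: c_def ennreal_mult')
  qed
  also have "\<dots> = ennreal c * ((\<integral>\<^sup>+x. ennreal (enn2real (H1 x) powr s) \<partial>lebesgue)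
      + (\<integral>\<^sup>+x. ennreal (enn2real (H2 x) powr s) \<partial>lebesgue))"
  proof -
    have meas: "(\<lambda>x. ennreal (enn2real (H1 x) powr s)) \<in> borel_measurable lebesgue"
      "(\<lambda>x. ennreal (enn2real (H2 x) powr s)) \<in> borel_measurable lebesgue"
      unfolding H1_def H2_def by (intro powr_meas H_meas h1_meas h2_meas)+
    show ?thesis
      unfolding nn_integral_add[OF meas, symmetric] by (intro nn_integral_cmult borel_measurable_add meas)
  qed
  also have "\<dots> \<le> ennreal c * (ennreal (G powr (s + 1 - s/1) * A1 powr s) + ennreal (G powr (s + 1 - s/q) * A2 powr s))"
    by (intro mult_left_mono add_mono H1_s H2_s) simp
  also have "\<dots> = ennreal (c * (G powr (s + 1 - s/1) * A1 powr s + G powr (s + 1 - s/q) * A2 powr s))"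
    by (simp add: ennreal_mult' c_def)
  also have "c * (G powr (s + 1 - s/1) * A1 powr s + G powr (s + 1 - s/q) * A2 powr s)
      = 2 powr s * ((G powr (1/s - 1) * A1) powr s + (G powr (1/s - 1/q) * A2) powr s)"
  proof -
    have e: "G powr (- s) * G powr (s + 1 - s/r) = (G powr (1/s - 1/r)) powr s" if "r > 0" for r
    proof -
      have "- s + (s + 1 - s/r) = (1/s - 1/r) * s" using s1 by (simp add: field_simps)
      then show ?thesis by (simp only: powr_add[symmetric] powr_powr)
    qed
    have "G powr (- s) * (G powr (s + 1 - s/r) * X powr s) = (G powr (1/s - 1/r) * X) powr s"
      if "r > 0" "X \<ge> 0" for r X
      using that by (simp only: mult.assoc[symmetric] e powr_mult powr_ge_zero)
    from this[of 1 A1] this[of q A2] show ?thesis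
      using A q by (simp add: c_def distrib_left mult.assoc)
  qed
  finally show "(\<integral>\<^sup>+x. ennreal (norm (heat t g x) powr s) \<partial>lebesgue)
      \<le> ennreal (2 powr s * ((G powr (1/s - 1) * A1) powr s + (G powr (1/s - 1/q) * A2) powr s))" .
qed

section \<open>The estimate on Morrey spaces\<close>

text \<open>
  Let $R = \sqrt t$. Near the origin the $L^1$ growth exponent $n - n/p$ of $f$ exceeds $\gamma$, so the part of
  $|x|^{-\gamma} f$ in the ball of radius $R$ is integrable; far out the growth exponent $n - nq/p$ of $|f|^q$ is less
  than $\gamma q$, so the rest is in $L^q$. The choice of $R$ makes both parts contribute the same power of $t$,
  as scaling demands. Measurability of the solution is included because Chebyshev's inequality uses it.
\<close>

lemma heat_singular_weight_morrey:
  fixes p q s \<gamma> :: real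
  defines "N \<equiv> real CARD('n::finite)"
  assumes q: "1 \<le> q" and s: "q \<le> s" and \<gamma>: "0 < \<gamma>"
    and lower: "N / q - N / p < \<gamma>" and upper: "\<gamma> < N - N / p"
  shows "\<exists>C>0. \<forall>t>0. \<forall>f \<in> (morrey_space p q :: (real ^ 'n \<Rightarrow> complex) set).
      heat_defined t (singular_weight \<gamma> f) \<and>
      heat t (singular_weight \<gamma> f) \<in> borel_measurable lebesgue \<and>
      L_norm s (heat t (singular_weight \<gamma> f))
        \<le> ennreal (C * t powr (- (N / 2) * (1 / p - 1 / s) - \<gamma> / 2)) * morrey_norm p q f"
proof -
  define e where "e = - (N / 2) * (1 / p - 1 / s) - \<gamma> / 2"
  define d1 where "d1 = N - N / p"
  define d2 where "d2 = N - N * q / p"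
  have d1: "\<gamma> < d1" using upper by (simp add: d1_def)
  have d2: "d2 < \<gamma> * q"
  proof -
    have "(N / q - N / p) * q < \<gamma> * q" using lower q by (intro mult_strict_right_mono) auto
    then show ?thesis using q by (simp add: d2_def left_diff_distrib)
  qed
  \<comment> \<open>The constants of the two parts: sums of geometric series over shells times Hoelder factors.\<close>
  define K1 where "K1 = unit_ball_vol N powr (1 - 1/q) * 2 powr d1 *
    ((1/2) powr (d1 - \<gamma>) * (1 / (1 - (1/2) powr (d1 - \<gamma>))))"
  define K2 where "K2 = (2 powr d2 * (1 / (1 - 2 powr (d2 - \<gamma> * q)))) powr (1/q)"
  have less1: "(1/2::real) powr (d1 - \<gamma>) < 1" "(2::real) powr (d2 - \<gamma> * q) < 1"
    using d1 d2 by (simp_all add: powr_divide gr_one_powr powr_less_one)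
  have "unit_ball_vol N > 0" by (simp add: N_def)
  then have K1: "K1 > 0" using less1 by (auto simp: K1_def intro!: mult_pos_pos divide_pos_pos)
  have K2: "K2 \<ge> 0" by (simp add: K2_def)
  have K2q: "K2 powr q = 2 powr d2 * (1 / (1 - 2 powr (d2 - \<gamma> * q)))"
    using less1 q by (simp add: K2_def powr_powr)
  \<comment> \<open>The constants after smoothing, once all powers of $t$ have been collected in $t^e$.\<close>
  define D1 where "D1 = ((4 * pi) powr (N/2)) powr (1/s - 1) * K1"
  define D2 where "D2 = ((4 * pi) powr (N/2)) powr (1/s - 1/q) * K2"
  have D: "D1 > 0" "D2 \<ge> 0" using K1 K2 by (simp_all add: D1_def D2_def)
  define C where "C = (2 powr s * (D1 powr s + D2 powr s)) powr (1/s)"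
  have "D1 powr s + D2 powr s > 0" using D by (intro add_pos_nonneg) auto
  then have C: "C > 0" by (simp add: C_def)
  have Cs: "C powr s = 2 powr s * (D1 powr s + D2 powr s)"
    using s q D by (simp add: C_def powr_powr)
  have "heat_defined t (singular_weight \<gamma> f) \<and>
      heat t (singular_weight \<gamma> f) \<in> borel_measurable lebesgue \<and>
      L_norm s (heat t (singular_weight \<gamma> f)) \<le> ennreal (C * t powr e) * morrey_norm p q f"
    if t: "t > 0" and f: "f \<in> morrey_space p q" for t and f :: "real ^ 'n \<Rightarrow> complex"
  proof -
    define M where "M = enn2real (morrey_norm p q f)"
    have f_meas: "f \<in> borel_measurable lebesgue" and M: "morrey_norm p q f = ennreal M" "0 \<le> M"
      using f by (simp_all add: morrey_space_def M_def)
    have f_norm: "(\<lambda>y. norm (f y)) \<in> borel_measurable lebesgue"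
      using f_meas by (rule measurable_compose) simp
    have f_normq: "(\<lambda>y. norm (f y) powr q) \<in> borel_measurable lebesgue"
      by (rule measurable_compose[OF f_norm]) simp
    let ?g = "singular_weight \<gamma> f"
    define R where "R = t powr (1/2)"
    have R: "R > 0" using t by (simp add: R_def)
    have g_meas: "?g \<in> borel_measurable lebesgue"
      unfolding singular_weight_def[abs_def]
      by (intro borel_measurable_scaleR f_meas measurable_completion) simp
    define A1 where "A1 = M * K1 * R powr (d1 - \<gamma>)"
    define A2 where "A2 = M * K2 * R powr (N / q - N / p - \<gamma>)"
    have A: "0 \<le> A1" "0 \<le> A2" using M K1 K2 by (simp_all add: A1_def A2_def)
    have near: "(\<integral>\<^sup>+y. ennreal (norm (?g y)) * indicator (ball 0 R) y \<partial>lebesgue) \<le> ennreal A1"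
    proof -
      have "(\<integral>\<^sup>+y. ennreal (norm (?g y)) * indicator (ball 0 R) y \<partial>lebesgue)
          = (\<integral>\<^sup>+y. ennreal (norm y powr (-\<gamma>) * norm (f y)) * indicator (ball 0 R) y \<partial>lebesgue)"
        by (simp add: singular_weight_def)
      also have "\<dots> \<le> ennreal ((unit_ball_vol N powr (1 - 1/q) * M) * 2 powr d1 *
          ((R/2) powr (d1 - \<gamma>) * (1 / (1 - (1/2) powr (d1 - \<gamma>)))))"
        unfolding d1_def N_def using upper \<gamma> R q M f_meas
        by (intro nn_integral_weight_ball f_norm morrey_norm_ball_L1) (auto simp: N_def)
      also have "(R/2) powr (d1 - \<gamma>) = R powr (d1 - \<gamma>) * (1/2) powr (d1 - \<gamma>)"
        using R by (simp add: powr_divide)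
      finally show ?thesis by (simp add: A1_def K1_def mult_ac)
    qed
    have far: "(\<integral>\<^sup>+y. ennreal (norm (?g y) powr q) * indicator (- ball 0 R) y \<partial>lebesgue) \<le> ennreal (A2 powr q)"
    proof -
      have "norm (?g y) powr q = norm y powr (- (\<gamma> * q)) * norm (f y) powr q" for y
        by (simp add: singular_weight_def powr_mult powr_powr)
      then have "(\<integral>\<^sup>+y. ennreal (norm (?g y) powr q) * indicator (- ball 0 R) y \<partial>lebesgue)
          = (\<integral>\<^sup>+y. ennreal (norm y powr (- (\<gamma> * q)) * norm (f y) powr q) * indicator (- ball 0 R) y \<partial>lebesgue)"
        by simp
      also have "\<dots> \<le> ennreal (M powr q * 2 powr d2 *
          (R powr (d2 - \<gamma> * q) * (1 / (1 - 2 powr (d2 - \<gamma> * q)))))"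
        using d2 \<gamma> R q M unfolding d2_def N_def
        by (intro nn_integral_weight_outside_ball f_normq morrey_norm_ball) auto
      also have "M powr q * 2 powr d2 * (R powr (d2 - \<gamma> * q) * (1 / (1 - 2 powr (d2 - \<gamma> * q))))
          = M powr q * K2 powr q * R powr (d2 - \<gamma> * q)"
        by (simp add: K2q)
      also have "d2 - \<gamma> * q = (N / q - N / p - \<gamma>) * q"
        using q by (simp add: d2_def algebra_simps)
      also have "M powr q * K2 powr q * R powr ((N / q - N / p - \<gamma>) * q) = A2 powr q"
        using M K2 R by (simp add: A2_def powr_mult powr_powr)
      finally show ?thesis .
    qed
    let ?G = "sqrt ((4 * pi * t) ^ CARD('n))"
    have s1: "1 \<le> s" using q s by simp
    have heat: "heat_defined t ?g" "heat t ?g \<in> borel_measurable lebesgue"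
      "(\<integral>\<^sup>+x. ennreal (norm (heat t ?g x) powr s) \<partial>lebesgue)
        \<le> ennreal (2 powr s * ((?G powr (1/s - 1) * A1) powr s + (?G powr (1/s - 1/q) * A2) powr s))"
      using heat_split_bound[OF g_meas _ t _ s A near far] q by auto
    have "?G = (4 * pi * t) powr (N/2)"
      using t by (simp add: N_def powr_half_sqrt[symmetric] powr_realpow[symmetric] powr_powr)
    then have G: "?G = (4 * pi) powr (N/2) * t powr (N/2)"
      using t by (simp add: powr_mult)
    have "?G powr (1/s - 1) * A1 = D1 * (t powr (N/2 * (1/s - 1)) * t powr (1/2 * (d1 - \<gamma>))) * M"
      using t by (simp add: G A1_def D1_def R_def powr_mult powr_powr)
    also have "t powr (N/2 * (1/s - 1)) * t powr (1/2 * (d1 - \<gamma>)) = t powr e"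
    proof -
      have "N/2 * (1/s - 1) + 1/2 * (d1 - \<gamma>) = e"
        by (simp add: e_def d1_def algebra_simps add_divide_distrib diff_divide_distrib)
      then show ?thesis by (simp only: powr_add[symmetric])
    qed
    finally have G1: "?G powr (1/s - 1) * A1 = D1 * (t powr e * M)" by simp
    have "?G powr (1/s - 1/q) * A2
        = D2 * (t powr (N/2 * (1/s - 1/q)) * t powr (1/2 * (N / q - N / p - \<gamma>))) * M"
      using t by (simp add: G A2_def D2_def R_def powr_mult powr_powr)
    also have "t powr (N/2 * (1/s - 1/q)) * t powr (1/2 * (N / q - N / p - \<gamma>)) = t powr e"
    proof -
      have "N/2 * (1/s - 1/q) + 1/2 * (N / q - N / p - \<gamma>) = e"
        by (simp add: e_def algebra_simps add_divide_distrib diff_divide_distrib)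
      then show ?thesis by (simp only: powr_add[symmetric])
    qed
    finally have G2: "?G powr (1/s - 1/q) * A2 = D2 * (t powr e * M)" by simp
    have "2 powr s * ((D1 * (t powr e * M)) powr s + (D2 * (t powr e * M)) powr s)
        = 2 powr s * (D1 powr s + D2 powr s) * (t powr e * M) powr s"
      using D M by (simp add: powr_mult algebra_simps)
    also have "\<dots> = (C * (t powr e * M)) powr s"
      using C M by (subst Cs[symmetric]) (simp add: powr_mult)
    finally have "(\<integral>\<^sup>+x. ennreal (norm (heat t ?g x) powr s) \<partial>lebesgue)
        \<le> ennreal ((C * (t powr e * M)) powr s)"
      using heat(3) unfolding G1 G2 by simp
    then have "L_norm s (heat t ?g) \<le> ennreal (C * (t powr e * M))"
      unfolding L_norm_def using C M s1 by (intro ennroot_le) auto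
    also have "\<dots> = ennreal (C * t powr e) * morrey_norm p q f"
      using C M by (simp add: ennreal_mult' mult.assoc)
    finally show ?thesis using heat by blast
  qed
  then show ?thesis using C unfolding e_def by blast
qed

theorem theorem1p2:
  fixes p q s \<gamma> :: real
  assumes "1 < q" and "q \<le> p" and "1 < s" and "0 < \<gamma>"
    and "real CARD('n::finite) / q - real CARD('n) / p < \<gamma>"
    and "\<gamma> < real CARD('n) - real CARD('n) / p"
  shows
    "(q \<le> s \<longrightarrow>
       (\<exists>C>0. \<forall>t>0. \<forall>f \<in> (morrey_space p q :: (real ^ 'n \<Rightarrow> complex) set).
          heat_defined t (singular_weight \<gamma> f) \<and>
          weak_L_norm s (heat t (singular_weight \<gamma> f))
            \<le> ennreal (C * t powr (- (real CARD('n) / 2) * (1 / p - 1 / s) - \<gamma> / 2))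
                * morrey_norm p q f))
     \<and>
     (q < s \<longrightarrow>
       (\<exists>C>0. \<forall>t>0. \<forall>f \<in> (morrey_space p q :: (real ^ 'n \<Rightarrow> complex) set).
          heat_defined t (singular_weight \<gamma> f) \<and>
          L_norm s (heat t (singular_weight \<gamma> f))
            \<le> ennreal (C * t powr (- (real CARD('n) / 2) * (1 / p - 1 / s) - \<gamma> / 2))
                * morrey_norm p q f))"
proof -
  have strong: "\<exists>C>0. \<forall>t>0. \<forall>f \<in> (morrey_space p q :: (real ^ 'n \<Rightarrow> complex) set).
      heat_defined t (singular_weight \<gamma> f) \<and>
      heat t (singular_weight \<gamma> f) \<in> borel_measurable lebesgue \<and>
      L_norm s (heat t (singular_weight \<gamma> f))
        \<le> ennreal (C * t powr (- (real CARD('n) / 2) * (1 / p - 1 / s) - \<gamma> / 2)) * morrey_norm p q f"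
    if "q \<le> s"
    using assms that by (intro heat_singular_weight_morrey) auto
  have weak: "weak_L_norm s h \<le> L_norm s h"
    if "h \<in> borel_measurable lebesgue" for h :: "real ^ 'n \<Rightarrow> complex"
    using that \<open>1 < s\<close> by (intro weak_L_norm_le_L_norm) auto
  show ?thesis
    using strong by (meson weak less_imp_le order_trans)
qed

end
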